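(* Let $\mathbb A=(A_1,\dots,A_n)$ be a tuple of compact, self-adjoint operators on a complex Hilbert space $H$, at least one of which is nonzero. Then the operators in $\mathbb A$ pairwise commute (that is, $A_iA_j=A_jA_i$ for all $1\le i,j\le n$) if and only if the set $\sigma_p(\mathbb A)\subset\mathbb C^n$ is the union of countably many, locally finite, complex hyperplanes in $\mathbb C^n$.
   Context: For an $n$-tuple $\mathbb A=(A_1,\dots,A_n)$ of bounded linear operators on $H$, the joint point spectrum is $$\sigma_p(\mathbb A)=\{(z_1,\dots,z_n)\in\mathbb C^n:\ker(I+z_1A_1+\cdots+z_nA_n)\neq(0)\}.$$ A complex hyperplane in $\mathbb C^n$ is an affine complex subspace of codimension one (those contained in $\sigma_p(\mathbb A)$ necessarily have the form $\lambda_1z_1+\cdots+\lambda_nz_n+1=0$ with $(\lambda_1,\dots,\lambda_n)\ne 0$, since $0\notin\sigma_p(\mathbb A)$). "Countably many" includes finitely many. A family of hyperplanes is locally finite if every point of $\mathbb C^n$ has a neighborhood meeting only finitely many members of the family. *)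

theory Defs
  imports "HOL-Analysis.Analysis"
begin

class complex_vector = real_vector +
  fixes scaleC :: "complex \<Rightarrow> 'a \<Rightarrow> 'a"  (infixr "*\<^sub>C" 75)
  assumes scaleC_add_right: "a *\<^sub>C (x + y) = a *\<^sub>C x + a *\<^sub>C y"
    and scaleC_add_left: "(a + b) *\<^sub>C x = a *\<^sub>C x + b *\<^sub>C x"
    and scaleC_scaleC: "a *\<^sub>C (b *\<^sub>C x) = (a * b) *\<^sub>C x"
    and scaleC_of_real: "complex_of_real r *\<^sub>C x = r *\<^sub>R x"

lemma scaleC_one: "1 *\<^sub>C x = (x :: 'a :: complex_vector)"
  using scaleC_of_real[of 1 x] by simp

(* The inner product is linear in the first argument, conjugate-linear in the second. *)
class complex_inner = complex_vector + real_normed_vector +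
  fixes cinner :: "'a \<Rightarrow> 'a \<Rightarrow> complex"
  assumes cinner_commute: "cinner x y = cnj (cinner y x)"
    and cinner_add_left: "cinner (x + y) z = cinner x z + cinner y z"
    and cinner_scaleC_left: "cinner (a *\<^sub>C x) y = a * cinner x y"
    and cinner_self_nonneg: "0 \<le> Re (cinner x x)"
    and cinner_eq_zero_iff: "cinner x x = 0 \<longleftrightarrow> x = 0"
    and norm_eq_sqrt_cinner: "norm x = sqrt (Re (cinner x x))"

class chilbert_space = complex_inner + complete_space

subclass (in chilbert_space) banach ..

instantiation complex :: chilbert_space
begin

definition scaleC_complex_def: "a *\<^sub>C (x :: complex) = a * x"

definition cinner_complex_def: "cinner x (y :: complex) = x * cnj y"

instance
  by standard
    (auto simp: scaleC_complex_def cinner_complex_def algebra_simps scaleR_conv_of_real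
      complex_norm cmod_def power2_eq_square)

end

definition bounded_clinear :: "('a::complex_inner \<Rightarrow> 'b::complex_inner) \<Rightarrow> bool"
  where "bounded_clinear T \<longleftrightarrow> bounded_linear T \<and> (\<forall>c x. T (c *\<^sub>C x) = c *\<^sub>C T x)"

definition compact_operator :: "('a::complex_inner \<Rightarrow> 'b::complex_inner) \<Rightarrow> bool"
  where "compact_operator T \<longleftrightarrow>
    bounded_clinear T \<and> (\<forall>S. bounded S \<longrightarrow> compact (closure (T ` S)))"

definition selfadjoint :: "('a::complex_inner \<Rightarrow> 'a) \<Rightarrow> bool"
  where "selfadjoint T \<longleftrightarrow> bounded_clinear T \<and> (\<forall>x y. cinner (T x) y = cinner x (T y))"

definition joint_point_spectrum ::
    "('n::finite \<Rightarrow> 'a::complex_inner \<Rightarrow> 'a) \<Rightarrow> (complex ^ 'n) set"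
  where "joint_point_spectrum A =
    {z. {x. x + (\<Sum>i\<in>UNIV. (z $ i) *\<^sub>C A i x) = 0} \<noteq> {0}}"

(* Here vec.subspace and vec.dim refer to the complex vector space structure of
   complex ^ 'n, whereas the unqualified subspace and dim are the real ones. *)
definition complex_hyperplane :: "(complex ^ 'n::finite) set \<Rightarrow> bool"
  where "complex_hyperplane S \<longleftrightarrow>
    (\<exists>p V. vec.subspace V \<and> vec.dim V + 1 = CARD('n) \<and> S = (\<lambda>v. p + v) ` V)"

end

theory Submission
  imports Defs
begin

text \<open>
Suppose first that the operators commute. Each joint eigenvector, with a tuple \<open>l\<close> of eigenvalues that
is not zero, contributes the hyperplane \<open>\<Sum>i. l $ i * z $ i = -1\<close> to the joint point spectrum
(\<open>pencil_joint_eigenvector\<close>). There is nothing else in it, because the kernel of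
\<open>I + \<Sum>i. z $ i A i\<close> is invariant under all the operators and so contains a joint eigenvector
(\<open>commuting_joint_eigenvector\<close>, \<open>joint_point_spectrum_commuting\<close>). By compactness the
tuples \<open>l\<close> can accumulate only at 0 (\<open>finite_large_joint_eigenvalues\<close>); hence they are countably
many, and as \<open>l\<close> tends to 0 the hyperplanes leave every bounded set.

Suppose conversely that the joint point spectrum is a countable union of hyperplanes. None of them
contains 0, so each is contained in a level set \<open>\<Sum>i. l $ i * z $ i = -1\<close>. By homogeneity every positive
eigenvalue of the operator \<open>T z = \<Sum>i. z $ i A i\<close>, for a real vector \<open>z\<close>, is the value at \<open>z\<close> of one of
countably many linear functions. The key claim is that then every nonzero closed invariant subspace
\<open>K\<close> contains a joint eigenvector
(\<open>joint_eigenvector_if_countably_many_linear_eigenvalues\<close>). To see this, let \<open>M z\<close> be the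
supremum of \<open>\<langle>T z x, x\<rangle>\<close> over the unit ball of \<open>K\<close>. Where \<open>M z\<close> is positive it is an eigenvalue, by
compactness (\<open>top_value_attained\<close>). As \<open>M\<close> is convex, hence continuous, Baire's theorem yields a ball
on which \<open>M\<close> is a single linear function \<open>l\<close> (\<open>Baire_linear_piece\<close>). A unit vector that attains the
supremum at the centre of that ball must then attain it everywhere in the ball, because
\<open>\<langle>T z x, x\<rangle>\<close> is also linear in \<open>z\<close>, and so it is an eigenvector of all the operators
(\<open>joint_eigenvector_if_top_value_linear\<close>).

The claim, applied to the orthogonal complement of all joint eigenvectors, shows that this complement is
zero. Commutators of the operators are antisymmetric and kill the joint eigenvectors, so their
ranges lie in that complement.
\<close>

section \<open>The real inner product\<close>

text \<open>All spectral arguments below concern self-adjoint operators and real eigenvalues, for which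
the real part of the inner product carries all the information that is needed.\<close>

definition rinner :: "'a::complex_inner \<Rightarrow> 'a \<Rightarrow> real"
  where "rinner x y = Re (cinner x y)"

lemma rinner_commute: "rinner x y = rinner y x"
  unfolding rinner_def by (subst cinner_commute) simp

lemma rinner_add_left: "rinner (x + y) z = rinner x z + rinner y z"
  by (simp add: rinner_def cinner_add_left)

lemma rinner_scaleR_left: "rinner (r *\<^sub>R x) y = r * rinner x y"
  by (simp add: rinner_def cinner_scaleC_left flip: scaleC_of_real)

lemma rinner_self: "rinner x x = (norm x)\<^sup>2"
  by (simp add: rinner_def norm_eq_sqrt_cinner cinner_self_nonneg)

lemma rinner_add_right: "rinner x (y + z) = rinner x y + rinner x z"
  using rinner_add_left[of y z x] by (simp add: rinner_commute)

lemma rinner_scaleR_right: "rinner x (r *\<^sub>R y) = r * rinner x y"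
  using rinner_scaleR_left[of r y x] by (simp add: rinner_commute)

text \<open>In this form the Cauchy--Schwarz inequality is the triangle inequality for \<open>x + y\<close>, squared.\<close>

lemma rinner_le_norm: "rinner x y \<le> norm x * norm y"
proof -
  have "(norm (x + y))\<^sup>2 \<le> (norm x + norm y)\<^sup>2"
    by (intro power_mono norm_triangle_ineq) auto
  moreover have "(norm (x + y))\<^sup>2 = (norm x)\<^sup>2 + 2 * rinner x y + (norm y)\<^sup>2"
    by (simp add: rinner_add_left rinner_add_right rinner_commute[of y x] flip: rinner_self)
  ultimately show ?thesis
    by (simp add: power2_sum)
qed

lemma rinner_abs_le_norm: "\<bar>rinner x y\<bar> \<le> norm x * norm y"
  using rinner_le_norm[of x y] rinner_le_norm[of "- x" y] rinner_scaleR_left[of "-1" x y]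
  by simp

interpretation rinner: bounded_bilinear "rinner :: 'a::complex_inner \<Rightarrow> 'a \<Rightarrow> real"
proof
  show "\<exists>K. \<forall>(a::'a) b. norm (rinner a b) \<le> norm a * norm b * K"
    by (rule exI[of _ 1]) (simp add: rinner_abs_le_norm)
qed (simp_all add: rinner_add_left rinner_add_right rinner_scaleR_left rinner_scaleR_right)

section \<open>Complex scaling\<close>

lemma scaleC_zero_left [simp]: "0 *\<^sub>C x = (0 :: 'a::complex_vector)"
  using scaleC_of_real[of 0 x] by simp

lemma scaleC_zero_right [simp]: "a *\<^sub>C 0 = (0 :: 'a::complex_vector)"
  by (metis mult_zero_right scaleC_scaleC scaleC_zero_left)

lemma scaleC_scaleR: "a *\<^sub>C (r *\<^sub>R x) = (a * of_real r) *\<^sub>C (x :: 'a::complex_vector)"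
  by (simp add: scaleC_scaleC flip: scaleC_of_real)

lemma scaleC_sum_left: "(\<Sum>i\<in>I. c i) *\<^sub>C x = (\<Sum>i\<in>I. c i *\<^sub>C (x :: 'a::complex_vector))"
  by (induction I rule: infinite_finite_induct) (simp_all add: scaleC_add_left)

lemma scaleC_eq_0_imp: "a *\<^sub>C x = 0 \<Longrightarrow> a = 0 \<or> x = (0 :: 'a::complex_vector)"
proof (rule disjCI)
  assume ax: "a *\<^sub>C x = 0" and "x \<noteq> 0"
  show "a = 0"
  proof (rule ccontr)
    assume "a \<noteq> 0"
    then have "x = inverse a *\<^sub>C (a *\<^sub>C x)"
      by (simp add: scaleC_scaleC scaleC_one)
    also have "\<dots> = 0"
      by (simp add: ax)
    finally show False
      using \<open>x \<noteq> 0\<close> by simp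
  qed
qed

lemma norm_scaleC: "norm (a *\<^sub>C x) = cmod a * norm (x :: 'a::complex_inner)"
proof -
  have "cinner (a *\<^sub>C x) (a *\<^sub>C x) = a * cnj a * cinner x x"
    using cinner_commute[of x "a *\<^sub>C x"] cinner_commute[of x x]
    by (simp add: cinner_scaleC_left)
  then have "rinner (a *\<^sub>C x) (a *\<^sub>C x) = (cmod a)\<^sup>2 * rinner x x"
    by (simp add: rinner_def flip: complex_norm_square)
  then have "(norm (a *\<^sub>C x))\<^sup>2 = (cmod a * norm x)\<^sup>2"
    by (simp add: rinner_self power_mult_distrib)
  then show ?thesis
    by (simp add: power2_eq_iff_nonneg)
qed

lemma bounded_linear_scaleC: "bounded_linear (\<lambda>x :: 'a::complex_inner. a *\<^sub>C x)"
proof (rule bounded_linear_intro[where K = "cmod a"])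
  show "a *\<^sub>C (r *\<^sub>R x) = r *\<^sub>R (a *\<^sub>C x)" for r and x :: 'a
    by (simp add: scaleC_scaleC mult.commute flip: scaleC_of_real)
qed (auto simp: scaleC_add_right norm_scaleC mult.commute)

section \<open>Compact symmetric operators\<close>

text \<open>Compactness is expressed by convergent subsequences, because two subsequences can be
extracted one after the other; this makes the closure under sums immediate.\<close>

definition compact_symmetric :: "('a::complex_inner \<Rightarrow> 'a) \<Rightarrow> bool"
  where "compact_symmetric T \<longleftrightarrow> bounded_linear T \<and> (\<forall>x y. rinner (T x) y = rinner x (T y)) \<and>
    (\<forall>x::nat \<Rightarrow> 'a. bounded (range x) \<longrightarrow> (\<exists>r. strict_mono r \<and> convergent (T \<circ> x \<circ> r)))"

lemma compact_symmetric_if_compact_selfadjoint: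
  assumes "compact_operator T" "selfadjoint T"
  shows "compact_symmetric T"
  unfolding compact_symmetric_def
proof (intro conjI allI impI)
  show "bounded_linear T"
    using assms by (simp add: compact_operator_def bounded_clinear_def)
  show "rinner (T x) y = rinner x (T y)" for x y
    using assms by (simp add: selfadjoint_def rinner_def)
  fix x :: "nat \<Rightarrow> 'a"
  assume "bounded (range x)"
  then have "compact (closure (T ` range x))"
    using assms(1) by (simp add: compact_operator_def)
  moreover have "(T \<circ> x) n \<in> closure (T ` range x)" for n
    using closure_subset by fastforce
  ultimately obtain l r where "strict_mono r" "((T \<circ> x) \<circ> r) \<longlonglongrightarrow> l"
    unfolding compact_def by metis
  then show "\<exists>r. strict_mono r \<and> convergent (T \<circ> x \<circ> r)"
    by (auto simp: convergent_def)
qed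

lemma compact_symmetric_zero: "compact_symmetric (\<lambda>x. 0)"
  unfolding compact_symmetric_def
  by (auto simp: rinner.zero_left rinner.zero_right o_def convergent_const intro: strict_mono_id)

lemma compact_symmetric_scaleR:
  assumes "compact_symmetric T"
  shows "compact_symmetric (\<lambda>x. c *\<^sub>R T x)"
  unfolding compact_symmetric_def
proof (intro conjI allI impI)
  show "bounded_linear (\<lambda>x. c *\<^sub>R T x)"
    using assms by (simp add: compact_symmetric_def bounded_linear_const_scaleR)
  show "rinner (c *\<^sub>R T x) y = rinner x (c *\<^sub>R T y)" for x y
    using assms by (simp add: compact_symmetric_def rinner.scaleR_left rinner.scaleR_right)
  fix x :: "nat \<Rightarrow> 'a"
  assume "bounded (range x)"
  then obtain r l where "strict_mono r" "(T \<circ> x \<circ> r) \<longlonglongrightarrow> l"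
    using assms unfolding compact_symmetric_def convergent_def by blast
  moreover from this have "(\<lambda>n. c *\<^sub>R T (x (r n))) \<longlonglongrightarrow> c *\<^sub>R l"
    by (intro tendsto_intros) (simp add: o_def)
  ultimately show "\<exists>r. strict_mono r \<and> convergent ((\<lambda>x. c *\<^sub>R T x) \<circ> x \<circ> r)"
    by (auto simp: convergent_def o_def)
qed

lemma compact_symmetric_add:
  assumes "compact_symmetric S" "compact_symmetric T"
  shows "compact_symmetric (\<lambda>x. S x + T x)"
  unfolding compact_symmetric_def
proof (intro conjI allI impI)
  show "bounded_linear (\<lambda>x. S x + T x)"
    using assms by (simp add: compact_symmetric_def bounded_linear_add)
  show "rinner (S x + T x) y = rinner x (S y + T y)" for x y
    using assms by (simp add: compact_symmetric_def rinner.add_left rinner.add_right)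
  fix x :: "nat \<Rightarrow> 'a"
  assume bx: "bounded (range x)"
  then obtain r l where r: "strict_mono r" "(S \<circ> x \<circ> r) \<longlonglongrightarrow> l"
    using assms(1) unfolding compact_symmetric_def convergent_def by blast
  have "bounded (range (x \<circ> r))"
    by (rule bounded_subset[OF bx]) auto
  then obtain q m where q: "strict_mono q" "(T \<circ> (x \<circ> r) \<circ> q) \<longlonglongrightarrow> m"
    using assms(2) unfolding compact_symmetric_def convergent_def by blast
  have "(S \<circ> x \<circ> r \<circ> q) \<longlonglongrightarrow> l"
    using r(2) q(1) by (rule LIMSEQ_subseq_LIMSEQ)
  with q(2) have "(\<lambda>n. S (x (r (q n))) + T (x (r (q n)))) \<longlonglongrightarrow> l + m"
    by (intro tendsto_add) (simp_all add: o_def)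
  then show "\<exists>r. strict_mono r \<and> convergent ((\<lambda>x. S x + T x) \<circ> x \<circ> r)"
    using strict_mono_o[OF r(1) q(1)] unfolding convergent_def
    by (intro exI[of _ "r \<circ> q"]) (auto simp: o_def)
qed

lemma compact_symmetric_sum:
  assumes "finite I" "\<And>i. i \<in> I \<Longrightarrow> compact_symmetric (T i)"
  shows "compact_symmetric (\<lambda>x. \<Sum>i\<in>I. c i *\<^sub>R T i x)"
  using assms
proof (induction I rule: finite_induct)
  case empty
  then show ?case by (simp add: compact_symmetric_zero)
next
  case (insert i I)
  then show ?case
    by (simp add: compact_symmetric_add compact_symmetric_scaleR)
qed

text \<open>A nonnegative form \<open>\<langle>Px, x\<rangle>\<close> controls \<open>Px\<close> itself, since it is still nonnegative at the point
\<open>x - Px / C\<close> reached by a gradient step, where \<open>C\<close> is a bound for the norm of \<open>P\<close>. So vectors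
at which the form is small are almost in the kernel of \<open>P\<close>.\<close>

lemma norm_le_quadratic_form:
  fixes P :: "'a::complex_inner \<Rightarrow> 'a"
  assumes P: "bounded_linear P" and sym: "\<And>x y. rinner (P x) y = rinner x (P y)"
    and K: "subspace K" "\<And>x. x \<in> K \<Longrightarrow> P x \<in> K"
    and pos: "\<And>x. x \<in> K \<Longrightarrow> rinner (P x) x \<ge> 0"
  shows "\<exists>C>0. \<forall>x\<in>K. (norm (P x))\<^sup>2 \<le> C * rinner (P x) x"
proof -
  interpret P: bounded_linear P by fact
  obtain C where C: "C > 0" "\<And>x. norm (P x) \<le> norm x * C"
    using P.pos_bounded by blast
  have "(norm (P x))\<^sup>2 \<le> C * rinner (P x) x" if x: "x \<in> K" for x
  proof -
    define y where "y = P x"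
    have "y \<in> K"
      using x K by (simp add: y_def)
    then have "0 \<le> rinner (P (x - (1/C) *\<^sub>R y)) (x - (1/C) *\<^sub>R y)"
      using x K(1) by (intro pos subspace_diff subspace_scale)
    also have "\<dots> = rinner (P x) x - 2/C * rinner y y + (1/C)\<^sup>2 * rinner (P y) y"
      by (simp add: P.diff P.scaleR rinner.diff_left rinner.diff_right rinner.scaleR_left
          rinner.scaleR_right sym[of y x] rinner_commute[of x y] y_def[symmetric] power2_eq_square
          sym[of x y] algebra_simps)
    also have "rinner (P y) y \<le> C * (norm y)\<^sup>2"
    proof -
      have "rinner (P y) y \<le> norm (P y) * norm y"
        by (rule rinner_le_norm)
      also have "\<dots> \<le> (norm y * C) * norm y"
        by (intro mult_right_mono C) auto
      finally show ?thesis by (simp add: power2_eq_square mult_ac)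
    qed
    then have "rinner (P x) x - 2/C * rinner y y + (1/C)\<^sup>2 * rinner (P y) y
        \<le> rinner (P x) x - 2/C * rinner y y + (1/C)\<^sup>2 * (C * (norm y)\<^sup>2)"
      by (intro add_left_mono mult_left_mono) auto
    also have "\<dots> = rinner (P x) x - (norm y)\<^sup>2 / C"
      using C(1) by (simp add: rinner_self field_simps power2_eq_square)
    finally show ?thesis
      using C(1) by (simp add: y_def field_simps)
  qed
  with C(1) show ?thesis by blast
qed

section \<open>The top of the spectrum on an invariant subspace\<close>

text \<open>The larger of 0 and the top of the spectrum of \<open>T\<close> on an invariant subspace \<open>K\<close>. The supremum is
over the unit ball and not over the unit sphere, so it is over a nonempty set even if
\<open>K = {0}\<close>, and it is never negative.\<close>

definition top_value :: "'a::complex_inner set \<Rightarrow> ('a \<Rightarrow> 'a) \<Rightarrow> real"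
  where "top_value K T = (SUP x\<in>K \<inter> cball 0 1. rinner (T x) x)"

lemma top_value_upper:
  assumes "bounded_linear T" "x \<in> K" "norm x \<le> 1"
  shows "rinner (T x) x \<le> top_value K T"
  unfolding top_value_def
proof (rule cSUP_upper)
  show "x \<in> K \<inter> cball 0 1"
    using assms by auto
  have "rinner (T x) x \<le> onorm T" if "x \<in> K \<inter> cball 0 1" for x
  proof -
    have x: "norm x \<le> 1" using that by auto
    have "rinner (T x) x \<le> norm (T x) * norm x"
      by (rule rinner_le_norm)
    also have "\<dots> \<le> (onorm T * norm x) * norm x"
      by (intro mult_right_mono onorm assms) auto
    also have "\<dots> \<le> onorm T * 1"
      using x onorm_pos_le[OF assms(1)] unfolding mult.assoc
      by (intro mult_left_mono mult_le_one) auto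
    finally show ?thesis by simp
  qed
  then show "bdd_above ((\<lambda>x. rinner (T x) x) ` (K \<inter> cball 0 1))"
    by (rule bdd_aboveI2)
qed

lemma quadratic_form_le_top_value:
  assumes "bounded_linear T" "subspace K" "x \<in> K"
  shows "rinner (T x) x \<le> top_value K T * (norm x)\<^sup>2"
proof (cases "x = 0")
  case True
  then show ?thesis by (simp add: rinner.zero_right)
next
  case False
  interpret T: bounded_linear T by fact
  define u where "u = (1 / norm x) *\<^sub>R x"
  have "rinner (T u) u \<le> top_value K T"
    using assms False by (intro top_value_upper) (auto simp: u_def subspace_scale)
  then show ?thesis
    using False by (simp add: u_def T.scaleR rinner.scaleR_left rinner.scaleR_right
        power2_eq_square field_simps)
qed

lemma top_value_nonneg:
  assumes "bounded_linear T" "subspace K"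
  shows "top_value K T \<ge> 0"
  using top_value_upper[OF assms(1), of 0 K] assms(2) by (simp add: subspace_0 rinner.zero_right)

text \<open>The inequality \<open>norm_le_quadratic_form\<close> for \<open>P = M - T\<close>, where \<open>M\<close> is the top value:
vectors that almost attain the supremum are almost eigenvectors.\<close>

lemma top_value_defect:
  assumes T: "compact_symmetric T" and K: "subspace K" "\<And>x. x \<in> K \<Longrightarrow> T x \<in> K"
  shows "\<exists>C>0. \<forall>x\<in>K. (norm (top_value K T *\<^sub>R x - T x))\<^sup>2
    \<le> C * (top_value K T * (norm x)\<^sup>2 - rinner (T x) x)"
proof -
  have bl: "bounded_linear T" and sym: "rinner (T x) y = rinner x (T y)" for x y
    using T by (auto simp: compact_symmetric_def)
  let ?P = "\<lambda>x. top_value K T *\<^sub>R x - T x"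
  have form: "rinner (?P x) x = top_value K T * (norm x)\<^sup>2 - rinner (T x) x" for x
    by (simp add: rinner.diff_left rinner.scaleR_left rinner_self)
  have "\<exists>C>0. \<forall>x\<in>K. (norm (?P x))\<^sup>2 \<le> C * rinner (?P x) x"
  proof (rule norm_le_quadratic_form)
    show "bounded_linear ?P"
      by (intro bounded_linear_sub bounded_linear_scaleR_right bl)
    show "rinner (?P x) y = rinner x (?P y)" for x y
      by (simp add: rinner.diff_left rinner.diff_right rinner.scaleR_left rinner.scaleR_right sym)
    show "?P x \<in> K" if "x \<in> K" for x
      using that K by (simp add: subspace_diff subspace_scale)
    show "0 \<le> rinner (?P x) x" if "x \<in> K" for x
      using quadratic_form_le_top_value[OF bl K(1) that] unfolding form by simp
  qed fact
  then show ?thesis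
    unfolding form .
qed

lemma maximizer_is_eigenvector:
  assumes "compact_symmetric T" "subspace K" "\<And>x. x \<in> K \<Longrightarrow> T x \<in> K"
    and "x \<in> K" "rinner (T x) x = top_value K T * (norm x)\<^sup>2"
  shows "T x = top_value K T *\<^sub>R x"
  using top_value_defect[OF assms(1-3)] assms(4,5) by fastforce

text \<open>For a maximising sequence \<open>s\<close> of the quadratic form, \<open>M s - T s\<close> tends to 0 by
\<open>top_value_defect\<close>. Compactness makes \<open>T s\<close> converge along a subsequence, hence also
\<open>M s\<close>, and as \<open>M > 0\<close> the sequence \<open>s\<close> converges to an eigenvector.\<close>

lemma top_value_attained:
  assumes T: "compact_symmetric T" and K: "subspace K" "closed K" "\<And>x. x \<in> K \<Longrightarrow> T x \<in> K"
    and pos: "top_value K T > 0"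
  obtains x where "x \<in> K" "norm x = 1" "T x = top_value K T *\<^sub>R x"
proof -
  define M where "M = top_value K T"
  have bl: "bounded_linear T"
    using T by (simp add: compact_symmetric_def)
  interpret T: bounded_linear T by fact
  obtain C where C: "C > 0"
      "\<And>x. x \<in> K \<Longrightarrow> (norm (M *\<^sub>R x - T x))\<^sup>2 \<le> C * (M * (norm x)\<^sup>2 - rinner (T x) x)"
    using top_value_defect[OF T K(1,3)] unfolding M_def by blast
  have "\<exists>x. x \<in> K \<inter> cball 0 1 \<and> M - 1 / real (Suc n) < rinner (T x) x" for n
  proof -
    have "K \<inter> cball 0 1 \<noteq> {}"
      using subspace_0[OF K(1)] by (metis IntI centre_in_cball empty_iff zero_le_one)
    moreover have "M - 1 / real (Suc n) < (SUP x\<in>K \<inter> cball 0 1. rinner (T x) x)"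
      by (simp add: M_def flip: top_value_def)
    ultimately show ?thesis
      using less_cSupD[of "(\<lambda>x. rinner (T x) x) ` (K \<inter> cball 0 1)"] by blast
  qed
  then obtain s where s: "\<And>n. s n \<in> K \<inter> cball 0 1"
      "\<And>n. M - 1 / real (Suc n) < rinner (T (s n)) (s n)"
    by metis
  have defect: "M * (norm (s n))\<^sup>2 - rinner (T (s n)) (s n) \<le> 1 / real (Suc n)" for n
  proof -
    have "M * (norm (s n))\<^sup>2 \<le> M * 1"
      using s(1)[of n] pos by (intro mult_left_mono) (auto simp: M_def power_le_one)
    then show ?thesis
      using s(2)[of n] by linarith
  qed
  have "(\<lambda>n. (norm (M *\<^sub>R s n - T (s n)))\<^sup>2) \<longlonglongrightarrow> 0"
  proof (rule tendsto_sandwich[where f = "\<lambda>_. 0"])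
    have "(\<lambda>n. C * (1 / real (Suc n))) \<longlonglongrightarrow> C * 0"
      by (intro tendsto_intros LIMSEQ_Suc[OF lim_1_over_n])
    then show "(\<lambda>n. C * (1 / real (Suc n))) \<longlonglongrightarrow> 0"
      by simp
    show "\<forall>\<^sub>F n in sequentially. (norm (M *\<^sub>R s n - T (s n)))\<^sup>2 \<le> C * (1 / real (Suc n))"
    proof (intro always_eventually allI)
      fix n
      have "(norm (M *\<^sub>R s n - T (s n)))\<^sup>2 \<le> C * (M * (norm (s n))\<^sup>2 - rinner (T (s n)) (s n))"
        using s(1) by (intro C(2)) auto
      also have "\<dots> \<le> C * (1 / real (Suc n))"
        using C(1) defect by (intro mult_left_mono) auto
      finally show "(norm (M *\<^sub>R s n - T (s n)))\<^sup>2 \<le> C * (1 / real (Suc n))" .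
    qed
  qed (auto intro: always_eventually)
  then have defect_lim: "(\<lambda>n. M *\<^sub>R s n - T (s n)) \<longlonglongrightarrow> 0"
    using tendsto_real_sqrt[of "\<lambda>n. (norm (M *\<^sub>R s n - T (s n)))\<^sup>2" 0]
    by (simp add: tendsto_norm_zero_iff)
  have "bounded (range s)"
    using s(1) by (intro bounded_subset[OF bounded_cball[of 0 1]]) auto
  then obtain r y where r: "strict_mono r" and y: "(\<lambda>n. T (s (r n))) \<longlonglongrightarrow> y"
    using T unfolding compact_symmetric_def convergent_def o_def by blast
  define x where "x = (1 / M) *\<^sub>R y"
  have "(\<lambda>n. (1/M) *\<^sub>R ((M *\<^sub>R s (r n) - T (s (r n))) + T (s (r n)))) \<longlonglongrightarrow> (1/M) *\<^sub>R (0 + y)"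
    using LIMSEQ_subseq_LIMSEQ[OF defect_lim r] y
    by (intro tendsto_intros) (simp_all add: o_def)
  then have lim: "(\<lambda>n. s (r n)) \<longlonglongrightarrow> x"
    using pos by (simp add: x_def M_def)
  have "T x = y"
    using T.tendsto[OF lim] y LIMSEQ_unique by blast
  then have eig: "T x = M *\<^sub>R x"
    using pos by (simp add: x_def M_def)
  have xK: "x \<in> K"
    using closed_sequentially[OF K(2) _ lim] s(1) by blast
  have "(\<lambda>n. rinner (T (s (r n))) (s (r n)) + 1 / real (Suc (r n))) \<longlonglongrightarrow> rinner (T x) x + 0"
    using LIMSEQ_subseq_LIMSEQ[OF LIMSEQ_Suc[OF lim_1_over_n] r]
    by (intro tendsto_add rinner.tendsto T.tendsto lim) (simp add: o_def)
  moreover have "\<exists>N. \<forall>n\<ge>N. M \<le> rinner (T (s (r n))) (s (r n)) + 1 / real (Suc (r n))"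
    using s(2) by (metis less_eq_real_def less_diff_eq diff_less_eq)
  ultimately have "M \<le> rinner (T x) x"
    using LIMSEQ_le_const by fastforce
  also have "rinner (T x) x = M * (norm x)\<^sup>2"
    by (simp add: eig rinner.scaleR_left rinner_self)
  finally have "1 \<le> (norm x)\<^sup>2"
    using pos by (simp add: M_def)
  then have ge: "1 \<le> norm x"
    using power2_le_imp_le[of 1 "norm x"] by simp
  have "norm x \<le> 1"
    using closed_sequentially[OF closed_cball _ lim, of 0 1] s(1) by simp
  then show ?thesis
    using that xK eig ge unfolding M_def by auto
qed

lemma zero_if_top_values_zero:
  assumes T: "compact_symmetric T" and K: "subspace K" "\<And>x. x \<in> K \<Longrightarrow> T x \<in> K"
    and "top_value K T \<le> 0" "top_value K (\<lambda>x. (-1) *\<^sub>R T x) \<le> 0" "x \<in> K"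
  shows "T x = 0"
proof -
  have "compact_symmetric (\<lambda>x. (-1) *\<^sub>R T x)"
    using T by (rule compact_symmetric_scaleR)
  then have bl: "bounded_linear T" "bounded_linear (\<lambda>x. (-1) *\<^sub>R T x)"
    using T unfolding compact_symmetric_def by blast+
  have top: "top_value K T = 0" "top_value K (\<lambda>x. (-1) *\<^sub>R T x) = 0"
    using top_value_nonneg[OF bl(1) K(1)] top_value_nonneg[OF bl(2) K(1)] assms(4,5) by auto
  have "rinner (T x) x = 0"
    using quadratic_form_le_top_value[OF bl(1) K(1) assms(6)]
      quadratic_form_le_top_value[OF bl(2) K(1) assms(6)]
    unfolding top by (simp add: rinner.minus_left)
  then show ?thesis
    using maximizer_is_eigenvector[OF T K assms(6)] by (simp add: top)
qed

text \<open>If neither \<open>T\<close> nor \<open>-T\<close> has a positive top value on \<open>K\<close>, then \<open>T\<close> vanishes on \<open>K\<close> and every vector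
of \<open>K\<close> is an eigenvector.\<close>

lemma eigenvector_exists:
  assumes T: "compact_symmetric T"
    and K: "subspace K" "closed K" "\<And>x. x \<in> K \<Longrightarrow> T x \<in> K" "K \<noteq> {0}"
  obtains x c where "x \<in> K" "x \<noteq> 0" "T x = c *\<^sub>R x"
proof -
  let ?S = "\<lambda>x. (-1) *\<^sub>R T x"
  have S: "compact_symmetric ?S"
    using T by (rule compact_symmetric_scaleR)
  have SK: "?S x \<in> K" if "x \<in> K" for x
    using K(1,3) that by (intro subspace_scale)
  consider "top_value K T > 0" | "top_value K ?S > 0"
    | "top_value K T \<le> 0" "top_value K ?S \<le> 0"
    by linarith
  then show ?thesis
  proof cases
    case 1
    then obtain x where "x \<in> K" "norm x = 1" "T x = top_value K T *\<^sub>R x"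
      using top_value_attained[OF T K(1-3)] by blast
    then show ?thesis
      using that[of x] by force
  next
    case 2
    then obtain x where "x \<in> K" "norm x = 1" "?S x = top_value K ?S *\<^sub>R x"
      using top_value_attained[OF S K(1,2) SK] by blast
    moreover from this have "T x = (- top_value K ?S) *\<^sub>R x"
      by (metis minus_equation_iff scaleR_minus_left scaleR_one)
    moreover from calculation have "x \<noteq> 0"
      by auto
    ultimately show ?thesis
      using that by blast
  next
    case 3
    obtain x where "x \<in> K" "x \<noteq> 0"
      using K(4) subspace_0[OF K(1)] by blast
    moreover have "T x = 0 *\<^sub>R x"
      using zero_if_top_values_zero[OF T K(1,3) 3] \<open>x \<in> K\<close> by simp
    ultimately show ?thesis
      using that by blast
  qed
qed

section \<open>Joint eigenvectors\<close>

text \<open>The eigenvalues of self-adjoint operators are real, so real tuples \<open>l\<close> suffice.\<close>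

definition joint_eigenvector :: "('n::finite \<Rightarrow> 'a::complex_inner \<Rightarrow> 'a) \<Rightarrow> real ^ 'n \<Rightarrow> 'a \<Rightarrow> bool"
  where "joint_eigenvector A l x \<longleftrightarrow> x \<noteq> 0 \<and> (\<forall>i. A i x = (l $ i) *\<^sub>R x)"

text \<open>Since the operators commute, the joint eigenspace of some of them is invariant under all of
them. So the operators can be treated one at a time, each contributing an eigenvector inside the
joint eigenspace already found.\<close>

lemma commuting_joint_eigenvector:
  fixes A :: "'n::finite \<Rightarrow> 'a::complex_inner \<Rightarrow> 'a"
  assumes A: "\<And>i. compact_symmetric (A i)"
    and comm: "\<And>i j x. A i (A j x) = A j (A i x)"
    and K: "subspace K" "closed K" "\<And>i x. x \<in> K \<Longrightarrow> A i x \<in> K" "K \<noteq> {0}"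
  obtains l x where "x \<in> K" "joint_eigenvector A l x"
proof -
  have bl: "bounded_linear (A i)" for i
    using A by (simp add: compact_symmetric_def)
  have lin: "linear (A i)" for i
    using bl by (rule bounded_linear.linear)
  define E where "E I l = {x \<in> K. \<forall>i\<in>I. A i x = l i *\<^sub>R x}" for I l
  have E_sub: "subspace (E I l)" for I l
    using K(1) unfolding E_def subspace_def
    by (auto simp: linear_0[OF lin] linear_add[OF lin] linear_scale[OF lin] scaleR_add_right)
  have E_closed: "closed (E I l)" for I l
  proof -
    have "E I l = K \<inter> (\<Inter>i\<in>I. {x. A i x = l i *\<^sub>R x})"
      by (auto simp: E_def)
    also have "closed \<dots>"
      by (intro closed_Int closed_INT K ballI closed_Collect_eq continuous_intros
          linear_continuous_on bl)
    finally show ?thesis .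
  qed
  have E_inv: "A j x \<in> E I l" if "x \<in> E I l" for I l x j
    using that K(3) by (auto simp: E_def comm[of _ j] linear_scale[OF lin])
  have "\<exists>l. E I l \<noteq> {0}" if "finite I" for I
    using that
  proof (induction I rule: finite_induct)
    case empty
    then show ?case using K(4) by (simp add: E_def)
  next
    case (insert i I)
    then obtain l where "E I l \<noteq> {0}" by blast
    then obtain x c where x: "x \<in> E I l" "x \<noteq> 0" "A i x = c *\<^sub>R x"
      using eigenvector_exists[OF A E_sub E_closed E_inv] by metis
    have "x \<in> E (insert i I) (l(i := c))"
      using x insert.hyps by (auto simp: E_def)
    with x(2) show ?case by blast
  qed
  then obtain l where "E UNIV l \<noteq> {0}"
    using finite[of UNIV] by metis
  moreover have "0 \<in> E UNIV l"
    using E_sub by (rule subspace_0)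
  ultimately obtain x where "x \<in> E UNIV l" "x \<noteq> 0"
    by auto
  then have "x \<in> K" "joint_eigenvector A (\<chi> i. l i) x"
    by (auto simp: E_def joint_eigenvector_def)
  then show ?thesis by (rule that)
qed

lemma joint_eigenvectors_orthogonal:
  assumes sym: "\<And>i. compact_symmetric (A i)"
    and "joint_eigenvector A l x" "joint_eigenvector A m y" "l \<noteq> m"
  shows "rinner x y = 0"
proof -
  obtain i where i: "l $ i \<noteq> m $ i"
    using \<open>l \<noteq> m\<close> by (auto simp: vec_eq_iff)
  have "rinner (A i x) y = rinner x (A i y)"
    using sym by (simp add: compact_symmetric_def)
  then show ?thesis
    using assms i by (simp add: joint_eigenvector_def rinner.scaleR_left rinner.scaleR_right)
qed

text \<open>Joint eigenvectors for different eigenvalue tuples are orthogonal. The images under \<open>A i\<close> of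
infinitely many orthonormal ones with \<open>\<bar>l $ i\<bar> \<ge> e\<close> would be at distance at least \<open>e\<close> from one
another, which compactness of \<open>A i\<close> forbids.\<close>

lemma finite_large_joint_eigenvalues:
  fixes A :: "'n::finite \<Rightarrow> 'a::complex_inner \<Rightarrow> 'a"
  assumes A: "\<And>i. compact_symmetric (A i)" and e: "e > 0"
  shows "finite {l. (\<exists>x. joint_eigenvector A l x) \<and> e \<le> \<bar>l $ i\<bar>}" (is "finite ?S")
proof (rule ccontr)
  assume "infinite ?S"
  then obtain f :: "nat \<Rightarrow> real ^ 'n" where f: "inj f" "range f \<subseteq> ?S"
    using infinite_countable_subset by blast
  have "\<exists>x. joint_eigenvector A (f n) x \<and> norm x = 1" for n
  proof -
    obtain x where x: "joint_eigenvector A (f n) x"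
      using f(2) by blast
    \<comment> \<open>Joint eigenvectors may be normalised.\<close>
    have "linear (A j)" for j
      using A by (simp add: compact_symmetric_def bounded_linear.linear)
    then have "joint_eigenvector A (f n) ((1 / norm x) *\<^sub>R x)"
      using x by (simp add: joint_eigenvector_def linear_scale)
    moreover have "norm ((1 / norm x) *\<^sub>R x) = 1"
      using x by (simp add: joint_eigenvector_def)
    ultimately show ?thesis by blast
  qed
  then obtain u where u: "\<And>n. joint_eigenvector A (f n) (u n)" "\<And>n. norm (u n) = 1"
    by metis
  have far: "e \<le> dist (A i (u m)) (A i (u n))" if "m \<noteq> n" for m n
  proof -
    have orth: "rinner (u m) (u n) = 0" "rinner (u n) (u m) = 0"
      using joint_eigenvectors_orthogonal[OF A u(1) u(1)] that inj_eq[OF f(1)] by metis+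
    have "A i (u k) = (f k $ i) *\<^sub>R u k" for k
      using u(1) by (simp add: joint_eigenvector_def)
    then have "(dist (A i (u m)) (A i (u n)))\<^sup>2 = (f m $ i)\<^sup>2 + (f n $ i)\<^sup>2"
      using orth rinner_self[of "u m"] rinner_self[of "u n"]
      by (simp add: u(2) dist_norm rinner.diff_left rinner.diff_right rinner.scaleR_left
          rinner.scaleR_right power2_eq_square[of "f _ $ i"] flip: rinner_self)
    moreover have "e\<^sup>2 \<le> (f m $ i)\<^sup>2"
    proof -
      have "e \<le> \<bar>f m $ i\<bar>"
        using f(2) by blast
      then show ?thesis
        using e by (metis abs_le_square_iff abs_of_pos)
    qed
    ultimately have "e\<^sup>2 \<le> (dist (A i (u m)) (A i (u n)))\<^sup>2"
      by (metis add.right_neutral add_mono zero_le_power2)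
    then show ?thesis
      by (rule power2_le_imp_le) simp
  qed
  have "bounded (range u)"
    using u(2) by (intro boundedI[of _ 1]) auto
  then obtain r where r: "strict_mono r" "convergent (A i \<circ> u \<circ> r)"
    using A[of i] unfolding compact_symmetric_def by blast
  then have "Cauchy (A i \<circ> u \<circ> r)"
    by (simp add: convergent_Cauchy)
  then obtain N where N: "dist ((A i \<circ> u \<circ> r) N) ((A i \<circ> u \<circ> r) (Suc N)) < e"
    using e unfolding Cauchy_def by (meson le_SucI order_refl)
  have "r N \<noteq> r (Suc N)"
    using r(1) by (simp add: strict_mono_eq)
  then show False
    using far[of "r N" "r (Suc N)"] N by simp
qed

section \<open>Pencils whose eigenvalues are countably many linear functions\<close>

text \<open>The sets on which \<open>f\<close> agrees with a given one of the linear functions are closed, and countably many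
of them cover a closed ball. By Baire's theorem one of them has interior points.\<close>

lemma Baire_linear_piece:
  fixes f :: "'b::euclidean_space \<Rightarrow> real"
  assumes f: "continuous_on UNIV f" and U: "open U" "U \<noteq> {}" and L: "countable L"
    and cover: "\<And>z. z \<in> U \<Longrightarrow> \<exists>l\<in>L. f z = l \<bullet> z"
  obtains l z e where "e > 0" "ball z e \<subseteq> U" "\<And>w. w \<in> ball z e \<Longrightarrow> f w = l \<bullet> w"
proof -
  obtain c d where d: "d > 0" "cball c d \<subseteq> U"
    using U open_contains_cball by blast
  define C where "C l = cball c d \<inter> {z. f z = l \<bullet> z}" for l
  have "closed (C l)" for l
    unfolding C_def
    by (intro closed_Int closed_cball closed_Collect_eq f continuous_intros)
  then have closed: "\<And>T. T \<in> C ` L \<Longrightarrow> closed T"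
    by blast
  have "(\<Union>l\<in>L. C l) = cball c d"
    using cover d(2) by (fastforce simp: C_def)
  then have "interior (\<Union>l\<in>L. C l) \<noteq> {}"
    using d(1) by (simp add: interior_cball)
  then have "\<exists>l\<in>L. interior (C l) \<noteq> {}"
    using Baire_category_alt[of euclidean "C ` L"] closed L completely_metrizable_space_euclidean
    by (auto simp: euclidean_interior_of)
  then obtain l w where "w \<in> interior (C l)"
    by blast
  then obtain e where "e > 0" "ball w e \<subseteq> C l"
    using mem_interior by blast
  then show ?thesis
    using d(2) by (intro that[of e w l]) (auto simp: C_def)
qed

text \<open>A supremum of functions that are linear in the coefficients is convex. This is used to obtain
continuity of the top value.\<close>

lemma convex_on_top_value_pencil:
  fixes A :: "'n::finite \<Rightarrow> 'a::complex_inner \<Rightarrow> 'a"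
  assumes A: "\<And>i. compact_symmetric (A i)" and K: "subspace K"
  shows "convex_on UNIV (\<lambda>z :: real ^ 'n. top_value K (\<lambda>x. \<Sum>i\<in>UNIV. z $ i *\<^sub>R A i x))"
proof (rule convex_onI)
  let ?T = "\<lambda>z x. \<Sum>i\<in>UNIV. z $ i *\<^sub>R A i x"
  fix t :: real and y z :: "real ^ 'n"
  assume t: "0 < t" "t < 1"
  have bl: "bounded_linear (?T z)" for z
    using compact_symmetric_sum[of UNIV A "\<lambda>i. z $ i"] A by (simp add: compact_symmetric_def)
  show "top_value K (?T ((1 - t) *\<^sub>R y + t *\<^sub>R z))
      \<le> (1 - t) * top_value K (?T y) + t * top_value K (?T z)"
    unfolding top_value_def[of K "?T ((1 - t) *\<^sub>R y + t *\<^sub>R z)"]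
  proof (rule cSUP_least)
    have "0 \<in> K \<inter> cball 0 1"
      using subspace_0[OF K] by simp
    then show "K \<inter> cball 0 1 \<noteq> {}"
      by blast
  next
    fix x assume x: "x \<in> K \<inter> cball 0 1"
    have "rinner (?T ((1 - t) *\<^sub>R y + t *\<^sub>R z) x) x
        = (1 - t) * rinner (?T y x) x + t * rinner (?T z x) x"
      by (simp add: rinner.sum_left rinner.scaleR_left rinner.add_left rinner.diff_left scaleR_add_left
          sum.distrib sum_subtractf sum_distrib_left algebra_simps)
    also have "\<dots> \<le> (1 - t) * top_value K (?T y) + t * top_value K (?T z)"
      using t x by (intro add_mono mult_left_mono top_value_upper bl) auto
    finally show "rinner (?T ((1 - t) *\<^sub>R y + t *\<^sub>R z) x) x
        \<le> (1 - t) * top_value K (?T y) + t * top_value K (?T z)" .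
  qed
qed simp

text \<open>Let \<open>x\<close> be a unit eigenvector for the top value at the point \<open>z\<close>. The function
\<open>w \<mapsto> \<langle>T w x, x\<rangle>\<close> is linear and lies below the top value, which is \<open>l \<bullet> w\<close> near \<open>z\<close>, with
equality at \<open>z\<close>. Two linear functions ordered near a point where they agree are equal.
So \<open>x\<close> attains the top value for all \<open>w\<close> near \<open>z\<close> and is an eigenvector of each of these \<open>T w\<close>;
taking differences shows that it is an eigenvector of each \<open>A i\<close>.\<close>

lemma joint_eigenvector_if_top_value_linear:
  fixes A :: "'n::finite \<Rightarrow> 'a::complex_inner \<Rightarrow> 'a"
  assumes A: "\<And>i. compact_symmetric (A i)"
    and K: "subspace K" "closed K" "\<And>i x. x \<in> K \<Longrightarrow> A i x \<in> K"
    and e: "e > 0"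
    and lin: "\<And>w. w \<in> ball z e \<Longrightarrow> top_value K (\<lambda>x. \<Sum>i\<in>UNIV. w $ i *\<^sub>R A i x) = l \<bullet> w"
    and pos: "top_value K (\<lambda>x. \<Sum>i\<in>UNIV. z $ i *\<^sub>R A i x) > 0"
  obtains x where "x \<in> K" "joint_eigenvector A l x"
proof -
  define T where "T w x = (\<Sum>i\<in>UNIV. w $ i *\<^sub>R A i x)" for w :: "real ^ 'n" and x
  have T: "compact_symmetric (T w)" for w
    unfolding T_def using A by (intro compact_symmetric_sum) auto
  then have bl: "bounded_linear (T w)" for w
    by (simp add: compact_symmetric_def)
  have TK: "T w x \<in> K" if "x \<in> K" for w x
    unfolding T_def using K(1,3) that by (intro subspace_sum subspace_scale)
  have T_add: "T (v + w) x = T v x + T w x" and T_minus: "T (- v) x = - T v x" for v w x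
    by (simp_all add: T_def scaleR_add_left sum.distrib sum_negf)
  have lin: "top_value K (T w) = l \<bullet> w" if "dist z w < e" for w
    using lin[of w] that by (simp add: T_def[abs_def])
  have "top_value K (T z) > 0"
    using pos by (simp add: T_def[abs_def])
  then obtain x where x: "x \<in> K" "norm x = 1" "T z x = top_value K (T z) *\<^sub>R x"
    using top_value_attained[OF T K(1,2) TK] by blast
  have Tz: "T z x = (l \<bullet> z) *\<^sub>R x"
    using x(3) lin[of z] e by simp
  have le: "rinner (T v x) x \<le> l \<bullet> v" if "norm v < e" for v
  proof -
    have "rinner (T (z + v) x) x \<le> l \<bullet> (z + v)"
      using top_value_upper[OF bl[of "z + v"] x(1)] x(2) lin[of "z + v"] that
      by (simp add: dist_norm)
    moreover have "rinner (T z x) x = l \<bullet> z"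
      using x(2) by (simp add: Tz rinner.scaleR_left rinner_self)
    ultimately show ?thesis
      by (simp add: T_add rinner.add_left inner_add_right)
  qed
  have eig: "T v x = (l \<bullet> v) *\<^sub>R x" if "norm v < e" for v
  proof -
    have "rinner (T v x) x = l \<bullet> v"
      using le[OF that] le[of "- v"] that by (simp add: T_minus rinner.minus_left)
    then have "rinner (T (z + v) x) x = l \<bullet> (z + v)"
      using x(2) by (simp add: T_add Tz rinner.add_left rinner.scaleR_left rinner_self inner_add_right)
    then have "T (z + v) x = (l \<bullet> (z + v)) *\<^sub>R x"
      using maximizer_is_eigenvector[OF T[of "z + v"] K(1) TK x(1)] x(2) lin[of "z + v"] that
      by (simp add: dist_norm)
    then show ?thesis
      by (simp add: T_add Tz inner_add_right scaleR_add_left)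
  qed
  have "A i x = (l $ i) *\<^sub>R x" for i
  proof -
    have "T ((e/2) *\<^sub>R axis i 1) x = (e/2) *\<^sub>R A i x"
      by (simp add: T_def axis_def if_distrib[of "\<lambda>c. c *\<^sub>R _"] if_distrib[of "(*) _"] cong: if_cong)
    moreover have "l \<bullet> ((e/2) *\<^sub>R axis i 1) = (e/2) * l $ i"
      by (simp add: inner_axis)
    moreover have "norm ((e/2) *\<^sub>R axis i (1::real)) < e"
      using e by simp
    ultimately have "(e/2) *\<^sub>R A i x = (e/2) *\<^sub>R ((l $ i) *\<^sub>R x)"
      using eig[of "(e/2) *\<^sub>R axis i 1"] by simp
    then show ?thesis
      using e by (metis divide_eq_0_iff less_irrefl scaleR_cancel_left zero_neq_numeral)
  qed
  moreover have "x \<noteq> 0"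
    using x(2) by auto
  ultimately have "joint_eigenvector A l x"
    by (simp add: joint_eigenvector_def)
  with x(1) show ?thesis by (rule that)
qed

text \<open>Where the top value of the pencil is positive, it is an eigenvalue and hence one of countably
many linear functions; by Baire's theorem it is linear on a ball. If it is positive nowhere, then the forms of both \<open>A i\<close> and
\<open>- A i\<close> are nonpositive on \<open>K\<close>, so all the operators vanish there and any nonzero vector will do.\<close>

lemma joint_eigenvector_if_countably_many_linear_eigenvalues:
  fixes A :: "'n::finite \<Rightarrow> 'a::complex_inner \<Rightarrow> 'a"
  assumes A: "\<And>i. compact_symmetric (A i)"
    and K: "subspace K" "closed K" "\<And>i x. x \<in> K \<Longrightarrow> A i x \<in> K" "K \<noteq> {0}"
    and L: "countable L"
    and eig: "\<And>z c x. \<lbrakk>x \<in> K; x \<noteq> 0; c > 0; (\<Sum>i\<in>UNIV. z $ i *\<^sub>R A i x) = c *\<^sub>R x\<rbrakk> \<Longrightarrow>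
      \<exists>l\<in>L. c = l \<bullet> z"
  obtains l x where "x \<in> K" "joint_eigenvector A l x"
proof -
  define T where "T z x = (\<Sum>i\<in>UNIV. z $ i *\<^sub>R A i x)" for z :: "real ^ 'n" and x
  define M where "M z = top_value K (T z)" for z
  have T: "compact_symmetric (T z)" for z
    unfolding T_def using A by (intro compact_symmetric_sum) auto
  have TK: "T z x \<in> K" if "x \<in> K" for z x
    unfolding T_def using K(1,3) that by (intro subspace_sum subspace_scale)
  have "convex_on UNIV M"
    unfolding M_def[abs_def] T_def[abs_def] by (rule convex_on_top_value_pencil[OF A K(1)])
  then have cont: "continuous_on UNIV M"
    by (intro convex_on_continuous) auto
  show ?thesis
  proof (cases "\<exists>z. M z > 0")
    case True
    define U where "U = {z. M z > 0}"
    have U: "open U" "U \<noteq> {}"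
      using True by (auto simp: U_def intro!: open_Collect_less cont continuous_intros)
    have "\<exists>l\<in>L. M z = l \<bullet> z" if z: "z \<in> U" for z
    proof -
      obtain x where "x \<in> K" "norm x = 1" "T z x = M z *\<^sub>R x"
        using top_value_attained[OF T K(1,2) TK] z unfolding U_def M_def by blast
      moreover from this have "x \<noteq> 0" by auto
      ultimately show ?thesis
        using eig[of x "M z" z] z by (simp add: U_def T_def)
    qed
    then obtain l z e where e: "e > 0" "ball z e \<subseteq> U" "\<And>w. w \<in> ball z e \<Longrightarrow> M w = l \<bullet> w"
      using Baire_linear_piece[OF cont U L] by metis
    have "z \<in> U"
      using e(1,2) by auto
    then show ?thesis
      using joint_eigenvector_if_top_value_linear[of A K e z l, OF A K(1-3) e(1)] e(3) that
      unfolding U_def M_def T_def[abs_def] by blast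
  next
    case False
    have "A i x = 0" if "x \<in> K" for i x
    proof (rule zero_if_top_values_zero[OF A K(1,3) _ _ that])
      have "T (axis i 1) = A i" "T (- axis i 1) = (\<lambda>x. (-1) *\<^sub>R A i x)"
        by (simp_all add: fun_eq_iff T_def axis_def if_distrib[of "\<lambda>c. c *\<^sub>R _"]
            if_distrib[of uminus] sum_negf cong: if_cong)
      then show "top_value K (A i) \<le> 0" "top_value K (\<lambda>x. (-1) *\<^sub>R A i x) \<le> 0"
        using False unfolding M_def by (metis linorder_not_less)+
    qed
    moreover obtain x where "x \<in> K" "x \<noteq> 0"
      using K(4) subspace_0[OF K(1)] by blast
    ultimately have "x \<in> K" "joint_eigenvector A 0 x"
      by (auto simp: joint_eigenvector_def)
    then show ?thesis by (rule that)
  qed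
qed

section \<open>Complex hyperplanes as level sets\<close>

text \<open>The hyperplane is \<open>p + V\<close>, where \<open>V\<close> is the kernel of the linear form. The dimension of
\<open>V\<close> follows because \<open>V\<close> and the single vector \<open>p\<close> outside it span the whole space.\<close>

lemma complex_hyperplane_level_set:
  fixes l :: "complex ^ 'n::finite"
  assumes "l \<noteq> 0"
  shows "complex_hyperplane {z. (\<Sum>i\<in>UNIV. l $ i * z $ i) = -1}"
proof -
  define \<phi> where "\<phi> z = (\<Sum>i\<in>UNIV. l $ i * z $ i)" for z :: "complex ^ 'n"
  have add: "\<phi> (x + y) = \<phi> x + \<phi> y" and scale: "\<phi> (c *s x) = c * \<phi> x" for x y c
    by (simp_all add: \<phi>_def sum.distrib sum_distrib_left algebra_simps)
  obtain k where k: "l $ k \<noteq> 0"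
    using assms by (auto simp: vec_eq_iff)
  define p where "p = axis k (- 1 / l $ k)"
  have p: "\<phi> p = -1"
    using k by (simp add: \<phi>_def p_def axis_def mult_delta_right)
  \<comment> \<open>Every \<open>z\<close> equals \<open>(z + \<phi> z p) - \<phi> z p\<close>, and the first summand lies in \<open>V\<close>.\<close>
  define V where "V = {z. \<phi> z = 0}"
  have V: "vec.subspace V"
    unfolding vec.subspace_def by (auto simp: V_def add scale) (simp add: \<phi>_def)
  have pV: "p \<notin> V"
    by (simp add: V_def p)
  have "z \<in> vec.span (insert p V)" for z
  proof -
    have "\<phi> (z + \<phi> z *s p) = 0"
      by (simp add: add scale p)
    then have "z + \<phi> z *s p \<in> V"
      by (simp add: V_def)
    then have "(z + \<phi> z *s p) - \<phi> z *s p \<in> vec.span (insert p V)"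
      by (intro vec.span_diff vec.span_scale vec.span_base) auto
    then show ?thesis by simp
  qed
  then have "vec.dim (insert p V) = CARD('n)"
    by (metis UNIV_eq_I vec.dim_span vec_dim_card)
  moreover have "vec.span V = V"
    using V by (simp add: vec.span_eq_iff)
  ultimately have "vec.dim V + 1 = CARD('n)"
    using pV by (simp add: vec.dim_insert)
  moreover have "{z. \<phi> z = -1} = (\<lambda>v. p + v) ` V"
  proof (intro equalityI subsetI)
    fix z assume "z \<in> {z. \<phi> z = -1}"
    then have "\<phi> (z + (-1) *s p) = 0"
      unfolding add scale by (simp add: p)
    then have "z + (-1) *s p \<in> V"
      by (simp add: V_def)
    moreover have "z = p + (z + (-1) *s p)"
      by (simp add: vec_eq_iff)
    ultimately show "z \<in> (\<lambda>v. p + v) ` V"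
      by blast
  qed (auto simp: V_def add p)
  ultimately show ?thesis
    using V unfolding complex_hyperplane_def \<phi>_def by blast
qed

text \<open>If the hyperplane is \<open>p + V\<close>, then \<open>p\<close> does not lie in \<open>V\<close>, so there is a linear form that
vanishes on \<open>V\<close> and takes the value \<open>-1\<close> at \<open>p\<close>.\<close>

lemma complex_hyperplane_avoiding_zero:
  fixes h :: "(complex ^ 'n::finite) set"
  assumes "complex_hyperplane h" "0 \<notin> h"
  obtains l :: "complex ^ 'n" where "\<And>z. z \<in> h \<Longrightarrow> (\<Sum>i\<in>UNIV. l $ i * z $ i) = -1"
proof -
  obtain p V where V: "vec.subspace V" and h: "h = (\<lambda>v. p + v) ` V"
    using assms(1) unfolding complex_hyperplane_def by blast
  have pV: "p \<notin> V"
  proof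
    assume "p \<in> V"
    then have "- p \<in> V"
      using V by (rule vec.subspace_neg[rotated])
    then show False
      using assms(2) by (force simp: h)
  qed
  obtain B where B: "B \<subseteq> V" "vec.independent B" "V \<subseteq> vec.span B"
    using vec.basis_exists[of V] by metis
  have span: "vec.span B = V"
    using B V by (simp add: subset_antisym vec.span_minimal)
  have "vec.independent (insert p B)"
    using B(2) pV span by (simp add: vec.independent_insert)
  then obtain g :: "complex ^ 'n \<Rightarrow> complex ^ 'n" where g: "Vector_Spaces.linear (*s) (*s) g"
      "\<And>b. b \<in> insert p B \<Longrightarrow> g b = (if b = p then vec (-1) else 0)"
    using vec.linear_independent_extend[of "insert p B" "\<lambda>b. if b = p then vec (-1) else 0"]
    by blast
  have gV: "g v = 0" if "v \<in> V" for v
  proof (rule vec.linear_eq_0_on_span[OF g(1), of B])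
    show "g b = 0" if "b \<in> B" for b
      using that g(2)[of b] B(1) pV by auto
  qed (use that span in simp)
  \<comment> \<open>The scalar form is a coordinate of \<open>g\<close>; any coordinate will do, as \<open>g p\<close> has all its entries equal to \<open>-1\<close>.\<close>
  define k :: 'n where "k = undefined"
  define l where "l = (\<chi> i. g (axis i 1) $ k)"
  have "(\<Sum>i\<in>UNIV. l $ i * z $ i) = -1" if "z \<in> h" for z
  proof -
    obtain v where v: "v \<in> V" "z = p + v"
      using \<open>z \<in> h\<close> h by blast
    have "g z = g p + g v"
      unfolding v(2) by (rule vec.linear_add[OF g(1)])
    then have "g z $ k = -1"
      using gV[OF v(1)] g(2)[of p] by simp
    moreover have "g z $ k = (\<Sum>i\<in>UNIV. z $ i * g (axis i 1) $ k)"
      using Cartesian_Space.linear_componentwise[OF g(1)] by blast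
    ultimately show ?thesis
      by (simp add: l_def mult.commute)
  qed
  then show ?thesis by (rule that)
qed

section \<open>Commuting operators\<close>

definition eigenvalue_hyperplane :: "real ^ 'n \<Rightarrow> (complex ^ 'n::finite) set"
  where "eigenvalue_hyperplane l = {z. (\<Sum>i\<in>UNIV. complex_of_real (l $ i) * z $ i) = -1}"

lemma pencil_joint_eigenvector:
  assumes "joint_eigenvector A l x"
  shows "x + (\<Sum>i\<in>UNIV. z $ i *\<^sub>C A i x) = (1 + (\<Sum>i\<in>UNIV. complex_of_real (l $ i) * z $ i)) *\<^sub>C x"
  using assms
  by (simp add: joint_eigenvector_def scaleC_scaleR scaleC_add_left scaleC_sum_left scaleC_one mult.commute)

text \<open>For a point \<open>z\<close> of the spectrum the kernel of the operator \<open>I + \<Sum>i. z $ i A i\<close> is invariant under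
all \<open>A i\<close>, by commutativity, and therefore contains a joint eigenvector. On it the operator
acts as the number \<open>1 + \<Sum>i. l $ i * z $ i\<close>, which must be 0.\<close>

lemma joint_point_spectrum_commuting:
  fixes A :: "'n::finite \<Rightarrow> 'a::complex_inner \<Rightarrow> 'a"
  assumes A: "\<And>i. compact_symmetric (A i)" "\<And>i. bounded_clinear (A i)"
    and comm: "\<And>i j x. A i (A j x) = A j (A i x)"
  shows "joint_point_spectrum A
    = (\<Union>l\<in>{l. l \<noteq> 0 \<and> (\<exists>x. joint_eigenvector A l x)}. eigenvalue_hyperplane l)"
proof (intro equalityI subsetI)
  fix z assume "z \<in> joint_point_spectrum A"
  define P where "P x = x + (\<Sum>i\<in>UNIV. z $ i *\<^sub>C A i x)" for x
  have bl: "bounded_linear (A i)" and A_scale: "A i (c *\<^sub>C x) = c *\<^sub>C A i x" for i c x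
    using A(2) by (auto simp: bounded_clinear_def)
  have P: "bounded_linear P"
    unfolding P_def
    by (intro bounded_linear_add bounded_linear_ident bounded_linear_sum
        bounded_linear_compose[OF bounded_linear_scaleC bl])
  have lin: "linear P"
    using P by (rule bounded_linear.linear)
  define K where "K = {x. P x = 0}"
  have "K \<noteq> {0}"
    using \<open>z \<in> joint_point_spectrum A\<close> by (simp add: K_def P_def joint_point_spectrum_def)
  moreover have "subspace K"
    unfolding K_def by (rule linear_subspace_kernel[OF lin])
  moreover have "closed K"
    unfolding K_def by (intro closed_Collect_eq linear_continuous_on P continuous_intros)
  moreover have "A j x \<in> K" if "x \<in> K" for j x
  proof -
    have "P (A j x) = A j (P x)"
      using bounded_linear.linear[OF bl[of j]]
      by (simp add: P_def linear_add linear_sum A_scale comm[of _ j])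
    also have "\<dots> = 0"
      using that bounded_linear.linear[OF bl[of j]] by (simp add: K_def linear_0)
    finally show ?thesis by (simp add: K_def)
  qed
  ultimately obtain l x where x: "x \<in> K" "joint_eigenvector A l x"
    using commuting_joint_eigenvector[of A K, OF A(1) comm] by metis
  then have "(1 + (\<Sum>i\<in>UNIV. complex_of_real (l $ i) * z $ i)) *\<^sub>C x = 0"
    using pencil_joint_eigenvector[OF x(2), of z] by (simp add: K_def P_def)
  then have "1 + (\<Sum>i\<in>UNIV. complex_of_real (l $ i) * z $ i) = 0"
    using scaleC_eq_0_imp x(2) by (auto simp: joint_eigenvector_def)
  then have "(\<Sum>i\<in>UNIV. complex_of_real (l $ i) * z $ i) = -1"
    by (simp add: add_eq_0_iff)
  moreover from this have "l \<noteq> 0"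
    by auto
  ultimately show "z \<in> (\<Union>l\<in>{l. l \<noteq> 0 \<and> (\<exists>x. joint_eigenvector A l x)}. eigenvalue_hyperplane l)"
    using x(2) by (auto simp: eigenvalue_hyperplane_def)
next
  fix z assume "z \<in> (\<Union>l\<in>{l. l \<noteq> 0 \<and> (\<exists>x. joint_eigenvector A l x)}. eigenvalue_hyperplane l)"
  then obtain l x where "joint_eigenvector A l x" "z \<in> eigenvalue_hyperplane l"
    by blast
  then have "x + (\<Sum>i\<in>UNIV. z $ i *\<^sub>C A i x) = 0" "x \<noteq> 0"
    by (simp_all add: pencil_joint_eigenvector eigenvalue_hyperplane_def) (simp add: joint_eigenvector_def)
  then show "z \<in> joint_point_spectrum A"
    by (auto simp: joint_point_spectrum_def)
qed

lemma countable_joint_eigenvalues: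
  fixes A :: "'n::finite \<Rightarrow> 'a::complex_inner \<Rightarrow> 'a"
  assumes A: "\<And>i. compact_symmetric (A i)"
  shows "countable {l. l \<noteq> 0 \<and> (\<exists>x. joint_eigenvector A l x)}"
proof (rule countable_subset)
  let ?S = "\<lambda>i n. {l. (\<exists>x. joint_eigenvector A l x) \<and> 1 / real (Suc n) \<le> \<bar>l $ i\<bar>}"
  have "finite (?S i n)" for i n
    by (rule finite_large_joint_eigenvalues[OF A]) simp
  then show "countable (\<Union>i. \<Union>n. ?S i n)"
    by (simp add: countable_finite)
  show "{l. l \<noteq> 0 \<and> (\<exists>x. joint_eigenvector A l x)} \<subseteq> (\<Union>i. \<Union>n. ?S i n)"
  proof
    fix l assume l: "l \<in> {l. l \<noteq> 0 \<and> (\<exists>x. joint_eigenvector A l x)}"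
    then obtain i where "\<bar>l $ i\<bar> > 0"
      by (auto simp: vec_eq_iff)
    then obtain n where "1 / real (Suc n) < \<bar>l $ i\<bar>"
      using nat_approx_posE by blast
    then show "l \<in> (\<Union>i. \<Union>n. ?S i n)"
      using l by (force intro: less_imp_le)
  qed
qed

text \<open>A hyperplane \<open>\<Sum>i. l $ i * z $ i = -1\<close> that meets a bounded set has a coefficient \<open>l $ i\<close> bounded away
from 0, and only finitely many joint eigenvalues have one.\<close>

lemma locally_finite_eigenvalue_hyperplanes:
  fixes A :: "'n::finite \<Rightarrow> 'a::complex_inner \<Rightarrow> 'a"
  assumes A: "\<And>i. compact_symmetric (A i)"
  shows "locally_finite_in euclidean
    (eigenvalue_hyperplane ` {l. l \<noteq> 0 \<and> (\<exists>x. joint_eigenvector A l x)})"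
  unfolding locally_finite_in_def
proof (intro conjI ballI)
  fix z :: "complex ^ 'n"
  define R where "R = norm z + 1"
  have R: "R > 0"
    by (simp add: R_def add_nonneg_pos)
  \<comment> \<open>On the unit ball around \<open>z\<close> all points have norm below \<open>R\<close>. If all \<open>\<bar>l $ i\<bar>\<close> were below this \<open>e\<close>, the sum of the \<open>n\<close> products would have modulus below 1.\<close>
  define e where "e = 1 / (real CARD('n) * R)"
  have e: "e > 0"
    using R by (simp add: e_def)
  let ?S = "\<lambda>i. {l. (\<exists>x. joint_eigenvector A l x) \<and> e \<le> \<bar>l $ i\<bar>}"
  have large: "\<exists>i. e \<le> \<bar>l $ i\<bar>" if w: "w \<in> eigenvalue_hyperplane l" "w \<in> ball z 1" for l w
  proof (rule ccontr)
    assume "\<nexists>i. e \<le> \<bar>l $ i\<bar>"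
    then have small: "\<bar>l $ i\<bar> < e" for i
      by (simp add: not_le)
    have "norm w < R"
      using w(2) norm_triangle_ineq2[of w z] by (simp add: R_def dist_norm norm_minus_commute)
    have "1 = cmod (\<Sum>i\<in>UNIV. complex_of_real (l $ i) * w $ i)"
      using w(1) by (simp add: eigenvalue_hyperplane_def)
    also have "\<dots> \<le> (\<Sum>i\<in>UNIV. cmod (complex_of_real (l $ i) * w $ i))"
      by (rule norm_sum)
    also have "\<dots> < (\<Sum>i\<in>(UNIV :: 'n set). e * R)"
    proof (rule sum_strict_mono)
      fix i
      have "\<bar>l $ i\<bar> * cmod (w $ i) \<le> \<bar>l $ i\<bar> * norm w"
        by (intro mult_left_mono Finite_Cartesian_Product.norm_nth_le) auto
      also have "\<dots> \<le> \<bar>l $ i\<bar> * R"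
        using \<open>norm w < R\<close> by (intro mult_left_mono) auto
      also have "\<dots> < e * R"
        using small R by (intro mult_strict_right_mono) auto
      finally show "cmod (complex_of_real (l $ i) * w $ i) < e * R"
        by (simp add: norm_mult)
    qed auto
    also have "\<dots> = 1"
      using R by (simp add: e_def)
    finally show False by simp
  qed
  have "finite (eigenvalue_hyperplane ` (\<Union>i. ?S i))"
    by (intro finite_imageI finite_UN_I finite_large_joint_eigenvalues A e) simp
  moreover have "{h \<in> eigenvalue_hyperplane ` {l. l \<noteq> 0 \<and> (\<exists>x. joint_eigenvector A l x)}.
      h \<inter> ball z 1 \<noteq> {}} \<subseteq> eigenvalue_hyperplane ` (\<Union>i. ?S i)"
  proof
    fix h assume "h \<in> {h \<in> eigenvalue_hyperplane ` {l. l \<noteq> 0 \<and> (\<exists>x. joint_eigenvector A l x)}.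
      h \<inter> ball z 1 \<noteq> {}}"
    then obtain l x where h: "h = eigenvalue_hyperplane l" "joint_eigenvector A l x"
        "h \<inter> ball z 1 \<noteq> {}"
      by blast
    then obtain w where w: "w \<in> eigenvalue_hyperplane l" "w \<in> ball z 1"
      by blast
    then obtain i where "l \<in> ?S i"
      using large[OF w] h(2) by blast
    then show "h \<in> eigenvalue_hyperplane ` (\<Union>i. ?S i)"
      unfolding h(1) by (intro imageI UN_I) auto
  qed
  ultimately have "finite {h \<in> eigenvalue_hyperplane ` {l. l \<noteq> 0 \<and> (\<exists>x. joint_eigenvector A l x)}.
      h \<inter> ball z 1 \<noteq> {}}"
    by (rule finite_subset[rotated])
  then show "\<exists>V. openin euclidean V \<and> z \<in> V \<and>
      finite {h \<in> eigenvalue_hyperplane ` {l. l \<noteq> 0 \<and> (\<exists>x. joint_eigenvector A l x)}. h \<inter> V \<noteq> {}}"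
    by (intro exI[of _ "ball z 1"]) auto
qed simp

lemma complex_hyperplane_eigenvalue_hyperplane:
  assumes "l \<noteq> 0"
  shows "complex_hyperplane (eigenvalue_hyperplane l)"
proof -
  have "(\<chi> i. complex_of_real (l $ i)) \<noteq> 0"
    using assms by (auto simp: vec_eq_iff)
  then show ?thesis
    using complex_hyperplane_level_set[of "\<chi> i. complex_of_real (l $ i)"]
    by (simp add: eigenvalue_hyperplane_def)
qed

section \<open>Commutativity from the spectrum\<close>

text \<open>Let \<open>K\<close> consist of the vectors orthogonal to all joint eigenvectors. If \<open>K\<close> were not zero, it would
contain a joint eigenvector, because the positive eigenvalues of the real pencil are given by the
countably many hyperplanes; but such a vector would be orthogonal to itself. So \<open>K = {0}\<close>. A commutator of two of the operators kills every joint
eigenvector and is antisymmetric, so its range is orthogonal to the joint eigenvectors; that is, its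
range lies in \<open>K\<close>.\<close>

lemma commute_if_spectrum_in_countably_many_hyperplanes:
  fixes A :: "'n::finite \<Rightarrow> 'a::complex_inner \<Rightarrow> 'a"
  assumes A: "\<And>i. compact_symmetric (A i)"
    and F: "countable F" "\<And>h. h \<in> F \<Longrightarrow> complex_hyperplane h" "joint_point_spectrum A = \<Union>F"
  shows "A i (A j x) = A j (A i x)"
proof -
  have bl: "bounded_linear (A i)" and sym: "rinner (A i x) y = rinner x (A i y)" for i x y
    using A by (auto simp: compact_symmetric_def)
  have lin: "linear (A i)" for i
    using bl by (rule bounded_linear.linear)
  have "0 \<notin> joint_point_spectrum A"
    by (simp add: joint_point_spectrum_def)
  then have "\<exists>l :: complex ^ 'n. \<forall>z\<in>h. (\<Sum>i\<in>UNIV. l $ i * z $ i) = -1" if h: "h \<in> F" for h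
  proof -
    have "0 \<notin> h"
      using \<open>0 \<notin> joint_point_spectrum A\<close> F(3) h by blast
    then show ?thesis
      using complex_hyperplane_avoiding_zero[OF F(2)[OF h]] by metis
  qed
  then obtain m :: "(complex ^ 'n) set \<Rightarrow> complex ^ 'n"
    where m: "\<And>h z. h \<in> F \<Longrightarrow> z \<in> h \<Longrightarrow> (\<Sum>i\<in>UNIV. m h $ i * z $ i) = -1"
    by metis
  \<comment> \<open>Eigenvalues of the pencil at real points are real, so the real parts of the coefficients already yield them.\<close>
  define L where "L = (\<lambda>h. \<chi> i. Re (m h $ i)) ` F"
  have eig: "\<exists>l\<in>L. c = l \<bullet> z"
    if "x \<noteq> 0" "c > 0" "(\<Sum>i\<in>UNIV. z $ i *\<^sub>R A i x) = c *\<^sub>R x" for z c x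
  proof -
    \<comment> \<open>A positive eigenvalue \<open>c\<close> of the pencil at \<open>z\<close> amounts to the spectral point \<open>- z / c\<close>, and the equation of a hyperplane through that point gives \<open>c\<close> as a linear function of \<open>z\<close>.\<close>
    define w where "w = (\<chi> i. complex_of_real (- (z $ i) / c))"
    have "(\<Sum>i\<in>UNIV. w $ i *\<^sub>C A i x) = (\<Sum>i\<in>UNIV. (-1/c) *\<^sub>R (z $ i *\<^sub>R A i x))"
      by (rule sum.cong) (simp_all only: w_def vec_lambda_beta scaleC_of_real scaleR_scaleR, simp)
    also have "\<dots> = (-1/c) *\<^sub>R (c *\<^sub>R x)"
      by (simp only: that(3) flip: scaleR_sum_right)
    also have "\<dots> = - x"
      using that(2) by simp
    finally have "x + (\<Sum>i\<in>UNIV. w $ i *\<^sub>C A i x) = 0"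
      by (simp only: add.right_inverse)
    then have "w \<in> joint_point_spectrum A"
      using that(1) unfolding joint_point_spectrum_def by blast
    then obtain h where h: "h \<in> F" "w \<in> h"
      using F(3) by blast
    have "-1 = Re (\<Sum>i\<in>UNIV. m h $ i * w $ i)"
      using m[OF h] by simp
    also have "\<dots> = - (\<Sum>i\<in>UNIV. Re (m h $ i) * z $ i) / c"
      by (simp add: w_def sum_negf sum_divide_distrib)
    finally have "c = (\<chi> i. Re (m h $ i)) \<bullet> z"
      using that(2) by (simp add: inner_vec_def field_simps)
    then show ?thesis
      using h(1) by (auto simp: L_def)
  qed
  define K where "K = {x. \<forall>l e. joint_eigenvector A l e \<longrightarrow> rinner x e = 0}"
  have K: "subspace K"
    by (auto simp: K_def subspace_def rinner.zero_left rinner.add_left rinner.scaleR_left)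
  have K_closed: "closed K"
  proof -
    have "K = (\<Inter>e\<in>{e. \<exists>l. joint_eigenvector A l e}. {x. rinner x e = 0})"
      by (auto simp: K_def)
    also have "closed \<dots>"
      by (intro closed_INT ballI closed_Collect_eq continuous_intros
          linear_continuous_on rinner.bounded_linear_left)
    finally show ?thesis .
  qed
  have K_inv: "A i x \<in> K" if "x \<in> K" for i x
    using that by (auto simp: K_def sym joint_eigenvector_def rinner.scaleR_right)
  have "K = {0}"
  proof (rule ccontr)
    assume "K \<noteq> {0}"
    have "\<exists>l x. x \<in> K \<and> joint_eigenvector A l x"
    proof (rule joint_eigenvector_if_countably_many_linear_eigenvalues[of A K L, OF A K K_closed])
      show "A i x \<in> K" if "x \<in> K" for i x
        using that by (rule K_inv)
      show "countable L"
        using F(1) by (simp add: L_def)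
      show "\<exists>l\<in>L. c = l \<bullet> z"
        if "x \<in> K" "x \<noteq> 0" "c > 0" "(\<Sum>i\<in>UNIV. z $ i *\<^sub>R A i x) = c *\<^sub>R x" for z c x
        using that(2-4) by (rule eig)
    qed (use \<open>K \<noteq> {0}\<close> in blast)+
    then obtain l x where "x \<in> K" "joint_eigenvector A l x"
      by blast
    then have "rinner x x = 0" "x \<noteq> 0"
      by (auto simp: K_def joint_eigenvector_def)
    then show False
      by (simp add: rinner_self)
  qed
  moreover have "A i (A j x) - A j (A i x) \<in> K"
    unfolding K_def
  proof (intro CollectI allI impI)
    fix l e assume "joint_eigenvector A l e"
    then have "A j (A i e) = A i (A j e)"
      by (simp add: joint_eigenvector_def linear_scale[OF lin])
    then show "rinner (A i (A j x) - A j (A i x)) e = 0"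
      by (simp add: rinner.diff_left sym)
  qed
  ultimately show ?thesis by simp
qed

theorem theoremA:
  fixes A :: "'n::finite \<Rightarrow> 'a::chilbert_space \<Rightarrow> 'a"
  assumes "\<And>i. compact_operator (A i)"
    and "\<And>i. selfadjoint (A i)"
    and "\<exists>i. A i \<noteq> (\<lambda>x. 0)"
  shows "(\<forall>i j. A i \<circ> A j = A j \<circ> A i) \<longleftrightarrow>
    (\<exists>F. countable F \<and> (\<forall>h\<in>F. complex_hyperplane h) \<and>
         locally_finite_in euclidean F \<and> joint_point_spectrum A = \<Union>F)"
proof
  have A: "compact_symmetric (A i)" for i
    using assms(1,2) by (rule compact_symmetric_if_compact_selfadjoint)
  {
    assume comm: "\<forall>i j. A i \<circ> A j = A j \<circ> A i"
    define F where "F = eigenvalue_hyperplane ` {l. l \<noteq> 0 \<and> (\<exists>x. joint_eigenvector A l x)}"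
    have "A i (A j x) = A j (A i x)" for i j x
      using comm by (metis comp_apply)
    moreover have "bounded_clinear (A i)" for i
      using assms(2) by (simp add: selfadjoint_def)
    ultimately have "joint_point_spectrum A = \<Union>F"
      unfolding F_def by (intro joint_point_spectrum_commuting A)
    moreover have "countable F"
      unfolding F_def by (intro countable_image countable_joint_eigenvalues A)
    moreover have "locally_finite_in euclidean F"
      unfolding F_def by (intro locally_finite_eigenvalue_hyperplanes A)
    moreover have "\<forall>h\<in>F. complex_hyperplane h"
      by (auto simp: F_def complex_hyperplane_eigenvalue_hyperplane)
    ultimately show "\<exists>F. countable F \<and> (\<forall>h\<in>F. complex_hyperplane h) \<and>
        locally_finite_in euclidean F \<and> joint_point_spectrum A = \<Union>F"
      by blast
  next
    assume "\<exists>F. countable F \<and> (\<forall>h\<in>F. complex_hyperplane h) \<and>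
        locally_finite_in euclidean F \<and> joint_point_spectrum A = \<Union>F"
    then show "\<forall>i j. A i \<circ> A j = A j \<circ> A i"
      using commute_if_spectrum_in_countably_many_hyperplanes[of A, OF A]
      by (intro allI ext) auto
  }
qed

end
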